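(* Let $(X,d_X)$ and $(Y,d_Y)$ be metric spaces. Suppose that every finite subset of $X$ is similarly embedded into $Y$, and vice versa (every finite subset of $Y$ is similarly embedded into $X$). Then $\operatorname{UBG}(X)=\operatorname{UBG}(Y)$.
   Context: All graphs are finite, simple and undirected. A finite subset $S\subseteq X$ is similarly embedded into $Y$ if there exist $r>0$ and a map $f\colon S\to Y$ such that $d_Y(f(a),f(b))=r\,d_X(a,b)$ for all $a,b\in S$ ($r$ and $f$ may depend on $S$). A graph $G=(V_G,E_G)$ is a unit ball graph on a metric space $(X,d)$ if there exist $\delta>0$ and a map $\rho\colon V_G\to X$ such that for distinct $u,v\in V_G$, $\{u,v\}\in E_G$ if and only if $d(\rho(u),\rho(v))\le\delta$. $\operatorname{UBG}(X)$ denotes the collection of all unit ball graphs on $X$. *)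

theory Defs
  imports "HOL-Analysis.Abstract_Metric_Spaces"
begin

text \<open>
  A graph is a pair of a vertex set and a set of two-element edges.  A metric space is a carrier
  set together with a distance function satisfying the library locale \<^locale>\<open>Metric_space\<close>,
  so that subspaces and the empty space are covered.
\<close>

type_synonym 'v ugraph = "'v set \<times> 'v set set"

definition finite_simple_graph :: "'v ugraph \<Rightarrow> bool" where
  "finite_simple_graph G \<longleftrightarrow>
     finite (fst G) \<and> (\<forall>e\<in>snd G. e \<subseteq> fst G \<and> card e = 2)"

definition unit_ball_graph_on :: "'a set \<Rightarrow> ('a \<Rightarrow> 'a \<Rightarrow> real) \<Rightarrow> 'v ugraph \<Rightarrow> bool" where
  "unit_ball_graph_on X d G \<longleftrightarrow>
     (\<exists>\<delta>>0. \<exists>\<rho>. \<rho> \<in> fst G \<rightarrow> X \<and>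
        (\<forall>u\<in>fst G. \<forall>v\<in>fst G. u \<noteq> v \<longrightarrow> ({u, v} \<in> snd G \<longleftrightarrow> d (\<rho> u) (\<rho> v) \<le> \<delta>)))"

text \<open>
  The vertices are drawn from an arbitrary type \<open>'v\<close>; the class of all unit ball graphs is
  represented by this family of sets, polymorphic in \<open>'v\<close>.
\<close>

definition UBG :: "'a set \<Rightarrow> ('a \<Rightarrow> 'a \<Rightarrow> real) \<Rightarrow> 'v ugraph set" where
  "UBG X d = {G. finite_simple_graph G \<and> unit_ball_graph_on X d G}"

definition similarly_embedded ::
  "'a set \<Rightarrow> ('a \<Rightarrow> 'a \<Rightarrow> real) \<Rightarrow> 'b set \<Rightarrow> ('b \<Rightarrow> 'b \<Rightarrow> real) \<Rightarrow> bool" where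
  "similarly_embedded S dX Y dY \<longleftrightarrow>
     (\<exists>r>0. \<exists>f. f \<in> S \<rightarrow> Y \<and> (\<forall>a\<in>S. \<forall>b\<in>S. dY (f a) (f b) = r * dX a b))"

end

theory Submission
  imports Defs
begin

text \<open>A unit ball representation of a finite graph involves only the finitely many points that
  are images of vertices, and only the comparison of their distances with a threshold. A similarity
  defined on these points multiplies all their distances by one positive ratio, so composing with it
  and scaling the threshold by the same ratio preserves every adjacency. \<open>UBG_mono\<close>
  turns this into one inclusion; exchanging the two spaces gives the other.\<close>

lemma UBG_mono:
  assumes emb: "\<And>S. finite S \<Longrightarrow> S \<subseteq> X \<Longrightarrow> similarly_embedded S dX Y dY"
  shows "UBG X dX \<subseteq> UBG Y dY"
proof
  fix G :: "'v ugraph"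
  assume "G \<in> UBG X dX"
  then have G: "finite_simple_graph G" and "unit_ball_graph_on X dX G"
    by (auto simp: UBG_def)
  then obtain \<delta> \<rho> where "\<delta> > 0" and \<rho>: "\<rho> \<in> fst G \<rightarrow> X"
    and adj: "\<And>u v. u \<in> fst G \<Longrightarrow> v \<in> fst G \<Longrightarrow> u \<noteq> v \<Longrightarrow>
      {u, v} \<in> snd G \<longleftrightarrow> dX (\<rho> u) (\<rho> v) \<le> \<delta>"
    unfolding unit_ball_graph_on_def by (elim exE conjE) simp
  \<comment> \<open>Finiteness of the vertex set enters here. The embedding is taken on the image of
    \<open>\<rho>\<close>, so distinct vertices placed at the same point cause no trouble.\<close>
  have "similarly_embedded (\<rho> ` fst G) dX Y dY"
    using G \<rho> by (intro emb) (auto simp: finite_simple_graph_def)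
  then obtain r f where "r > 0" and f: "f \<in> \<rho> ` fst G \<rightarrow> Y"
    and sim: "\<forall>a\<in>\<rho> ` fst G. \<forall>b\<in>\<rho> ` fst G. dY (f a) (f b) = r * dX a b"
    unfolding similarly_embedded_def by (elim exE conjE)
  have "unit_ball_graph_on Y dY G"
    unfolding unit_ball_graph_on_def
  proof (intro exI conjI ballI impI)
    show "r * \<delta> > 0"
      using \<open>r > 0\<close> \<open>\<delta> > 0\<close> by simp
    show "f \<circ> \<rho> \<in> fst G \<rightarrow> Y"
      using f by auto
    \<comment> \<open>Both sides of the old comparison have been multiplied by \<open>r\<close>,
      which cancels because it is positive.\<close>
    show "{u, v} \<in> snd G \<longleftrightarrow> dY ((f \<circ> \<rho>) u) ((f \<circ> \<rho>) v) \<le> r * \<delta>"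
      if "u \<in> fst G" "v \<in> fst G" "u \<noteq> v" for u v
      using adj[OF that] sim that(1,2) \<open>r > 0\<close> by simp
  qed
  with G show "G \<in> UBG Y dY"
    by (simp add: UBG_def)
qed

theorem corollary2p5:
  fixes X :: "'a set" and dX :: "'a \<Rightarrow> 'a \<Rightarrow> real"
    and Y :: "'b set" and dY :: "'b \<Rightarrow> 'b \<Rightarrow> real"
  assumes "Metric_space X dX"
    and "Metric_space Y dY"
    and "\<And>S. finite S \<Longrightarrow> S \<subseteq> X \<Longrightarrow> similarly_embedded S dX Y dY"
    and "\<And>S. finite S \<Longrightarrow> S \<subseteq> Y \<Longrightarrow> similarly_embedded S dY X dX"
  shows "(UBG X dX :: 'v ugraph set) = UBG Y dY"
  \<comment> \<open>Each inclusion consumes one of the two embedding hypotheses.\<close>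
  by (rule equalityI; rule UBG_mono; rule assms)

end
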